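(* For every $T\in C_{11}(\mathbb{C}^2)$, the harmonic mean of the Cesàro asymptotic limits $A_{T,C}$ and $A_{T^*,C}$ is the identity, i.e. $$A_{T,C}^{-1}+A_{T^*,C}^{-1}=2I_2,$$ where $I_2$ is the $2\times2$ identity matrix.
   Context: $\mathbb{C}^2$ carries the usual inner product; matrices are identified with operators. A matrix $T$ is powerbounded if there is $M>0$ with $\|T^n\|<M$ for all $n\in\mathbb{N}=\{1,2,\dots\}$ (operator norm). The Cesàro asymptotic limit of a matrix $T$ is $A_{T,C}=\lim_{n\to\infty}\frac1n\sum_{j=1}^n T^{*j}T^j$ (entrywise limit), if this limit exists; it exists for every powerbounded matrix. A Banach limit is a bounded linear functional $L:\ell^\infty\to\mathbb{C}$ with $\|L\|=1$, agreeing with the usual limit on convergent sequences, positive, and shift-invariant. For powerbounded $T$ and a Banach limit $L$, $A_{T,L}$ is the unique positive operator with $\langle A_{T,L}x,y\rangle = L\big((\langle T^nx,T^ny\rangle)_{n\ge1}\big)$ for all $x,y$; its kernel is $\{x:T^nx\to0\}$, independent of $L$. $C_{11}(\mathbb{C}^2)$ is the set of powerbounded $2\times2$ complex matrices $T$ such that both $A_{T,L}$ and $A_{T^*,L}$ are injective (equivalently, invertible). *)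

theory Defs
  imports "HOL-Analysis.Analysis"
begin

definition cinner_vec :: "complex ^ 'n \<Rightarrow> complex ^ 'n \<Rightarrow> complex" where
  "cinner_vec x y = (\<Sum>i\<in>UNIV. x $ i * cnj (y $ i))"

definition cadjoint :: "complex ^ 'n ^ 'm \<Rightarrow> complex ^ 'm ^ 'n" where
  "cadjoint A = (\<chi> i j. cnj (A $ j $ i))"

text \<open>The library's power \<open>T ^ n\<close> on this type is entrywise, so powers with respect to
  the matrix product are introduced separately.\<close>

primrec mpow :: "complex ^ 'n ^ 'n \<Rightarrow> nat \<Rightarrow> complex ^ 'n ^ 'n" where
  "mpow T 0 = mat 1"
| "mpow T (Suc n) = T ** mpow T n"

definition powerbounded :: "complex ^ 'n ^ 'n \<Rightarrow> bool" where
  "powerbounded T \<longleftrightarrow> (\<exists>M>0. \<forall>n\<ge>1. onorm (\<lambda>x. mpow T n *v x) < M)"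

definition positive_matrix :: "complex ^ 'n ^ 'n \<Rightarrow> bool" where
  "positive_matrix A \<longleftrightarrow>
    (\<forall>x. cinner_vec (A *v x) x \<in> \<real> \<and> 0 \<le> Re (cinner_vec (A *v x) x))"

definition cesaro_mean :: "complex ^ 'n ^ 'n \<Rightarrow> nat \<Rightarrow> complex ^ 'n ^ 'n" where
  "cesaro_mean T n = (1 / real n) *\<^sub>R (\<Sum>j=1..n. mpow (cadjoint T) j ** mpow T j)"

definition cesaro_limit :: "complex ^ 'n ^ 'n \<Rightarrow> complex ^ 'n ^ 'n" where
  "cesaro_limit T = lim (cesaro_mean T)"

text \<open>Since \<open>nat\<close> is discrete, \<open>nat \<Rightarrow>\<^sub>C complex\<close> with its supremum norm is the space of
  bounded complex sequences. It is only a real normed space in the library, so complex homogeneity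
  is required in addition to \<^const>\<open>bounded_linear\<close>; the operator norm is the same over either
  scalar field. Sequences indexed by \<open>1, 2, \<dots>\<close> are stored with the index shifted by one.\<close>

definition banach_limit :: "((nat \<Rightarrow>\<^sub>C complex) \<Rightarrow> complex) \<Rightarrow> bool" where
  "banach_limit L \<longleftrightarrow>
     bounded_linear L \<and>
     (\<forall>c f g. (\<forall>n. apply_bcontfun g n = c * apply_bcontfun f n) \<longrightarrow> L g = c * L f) \<and>
     onorm L = 1 \<and>
     (\<forall>f l. apply_bcontfun f \<longlonglongrightarrow> l \<longrightarrow> L f = l) \<and>
     (\<forall>f. (\<forall>n. apply_bcontfun f n \<in> \<real> \<and> 0 \<le> Re (apply_bcontfun f n)) \<longrightarrow>
        L f \<in> \<real> \<and> 0 \<le> Re (L f)) \<and>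
     (\<forall>f g. (\<forall>n. apply_bcontfun g n = apply_bcontfun f (Suc n)) \<longrightarrow> L g = L f)"

text \<open>Meaningful for powerbounded \<open>T\<close>, for which the sequences below are bounded.\<close>

definition asymptotic_limit ::
    "((nat \<Rightarrow>\<^sub>C complex) \<Rightarrow> complex) \<Rightarrow> complex ^ 'n ^ 'n \<Rightarrow> complex ^ 'n ^ 'n" where
  "asymptotic_limit L T = (THE A. positive_matrix A \<and>
     (\<forall>x y. cinner_vec (A *v x) y =
        L (Bcontfun (\<lambda>n. cinner_vec (mpow T (Suc n) *v x) (mpow T (Suc n) *v y)))))"

text \<open>The kernel of \<^term>\<open>asymptotic_limit L T\<close> does not depend on the Banach limit \<open>L\<close>, so
  it makes no difference whether injectivity is demanded for one \<open>L\<close> or for all of them.\<close>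

definition C11 :: "(complex ^ 'n ^ 'n) set" where
  "C11 = {T. powerbounded T \<and>
     (\<exists>L. banach_limit L \<and>
        inj (\<lambda>x. asymptotic_limit L T *v x) \<and>
        inj (\<lambda>x. asymptotic_limit L (cadjoint T) *v x))}"

end

theory Submission
  imports Defs
begin

text \<open>Injectivity of \<open>A\<^sub>T\<^sub>,\<^sub>L\<close> means that no nonzero orbit of \<open>T\<close> tends to \<open>0\<close>. Together with power
  boundedness this makes both eigenvalues of \<open>T\<close> unimodular and excludes a Jordan block, so \<open>T\<close> is
  scalar or \<open>T = \<lambda>P + \<mu>Q\<close> with \<open>\<lambda> \<noteq> \<mu>\<close>, \<open>P\<close> a rank-one idempotent and \<open>Q = 1 - P\<close>. Averaging
  removes the cross terms of \<open>T\<^sup>*\<^sup>j T\<^sup>j\<close>, which leaves the limits \<open>A = P\<^sup>*P + Q\<^sup>*Q\<close> and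
  \<open>B = PP\<^sup>* + QQ\<^sup>*\<close>. In dimension two \<open>Q\<close> is the adjugate of \<open>P\<close>, and then \<open>B\<close> is the adjugate of
  \<open>A\<close> while \<open>det A = tr A / 2\<close>. Hence \<open>A\<^sup>-\<^sup>1 + B\<^sup>-\<^sup>1 = (B + A) / det A = (tr A / det A) I = 2I\<close>.\<close>

section \<open>Norms, inner products and matrix entries in coordinates\<close>

lemma norm_vector_smult:
  fixes x :: "complex ^ 'n"
  shows "norm (c *s x) = norm c * norm x"
  by (simp add: norm_vec_def norm_mult L2_set_right_distrib)

lemma norm_cinner_vec_le:
  fixes x :: "complex ^ 'n"
  shows "norm (cinner_vec x y) \<le> real CARD('n) * (norm x * norm y)"
proof -
  have "norm (cinner_vec x y) \<le> (\<Sum>i\<in>(UNIV :: 'n set). norm x * norm y)"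
    unfolding cinner_vec_def
    by (rule sum_norm_le) (simp add: norm_mult mult_mono Finite_Cartesian_Product.norm_nth_le)
  then show ?thesis by simp
qed

lemma matrix_mult_axis: "(A *v axis j 1) $ i = (A $ i $ j :: 'a::semiring_1)"
  by (simp add: matrix_vector_mult_def axis_def mult_delta_right)

lemma cinner_vec_axis [simp]: "cinner_vec (A *v axis j 1) (axis i 1) = A $ i $ j"
proof -
  have "cinner_vec (A *v axis j 1) (axis i 1) = (\<Sum>k\<in>UNIV. if k = i then (A *v axis j 1) $ k else 0)"
    unfolding cinner_vec_def by (rule sum.cong) (auto simp: axis_def)
  then show ?thesis by (simp add: matrix_mult_axis)
qed

lemma cinner_vec_self: "cinner_vec x x = of_real (\<Sum>i\<in>UNIV. (norm (x $ i))\<^sup>2)"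
  by (simp add: cinner_vec_def complex_norm_square flip: of_real_power)

lemma cinner_vec_self_eq_0: "cinner_vec x x = 0 \<longleftrightarrow> x = 0"
proof
  assume "cinner_vec x x = 0"
  then have "(\<Sum>i\<in>UNIV. (norm (x $ i))\<^sup>2) = 0"
    by (metis cinner_vec_self of_real_eq_0_iff)
  then show "x = 0"
    by (simp add: sum_nonneg_eq_0_iff vec_eq_iff)
qed (simp add: cinner_vec_def)

lemma powerboundedE:
  assumes "powerbounded T"
  obtains M where "\<And>n x. norm (mpow T (Suc n) *v x) \<le> M * norm x"
proof -
  obtain M where M: "\<And>n. n \<ge> 1 \<Longrightarrow> onorm (\<lambda>x. mpow T n *v x) < M"
    using assms by (auto simp: powerbounded_def)
  have "norm (mpow T (Suc n) *v x) \<le> M * norm x" for n x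
  proof -
    have "norm (mpow T (Suc n) *v x) \<le> onorm (\<lambda>x. mpow T (Suc n) *v x) * norm x"
      by (rule onorm) (rule matrix_vector_mul_bounded_linear)
    also have "\<dots> \<le> M * norm x"
      using M[of "Suc n"] by (intro mult_right_mono) auto
    finally show ?thesis .
  qed
  then show ?thesis by (rule that)
qed

section \<open>Well-definedness and kernel of the asymptotic limit\<close>

definition orbit_inner :: "complex ^ 'n ^ 'n \<Rightarrow> complex ^ 'n \<Rightarrow> complex ^ 'n \<Rightarrow> nat \<Rightarrow> complex" where
  "orbit_inner T x y n = cinner_vec (mpow T (Suc n) *v x) (mpow T (Suc n) *v y)"

text \<open>Since \<open>nat\<close> is discrete, continuity is automatic and boundedness is all
  that \<open>Bcontfun\<close> asks for.\<close>

lemma apply_Bcontfun_nat: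
  fixes f :: "nat \<Rightarrow> 'a::metric_space"
  assumes "bounded (range f)"
  shows "apply_bcontfun (Bcontfun f) = f"
  using assms by (intro Bcontfun_inverse) (simp add: bcontfun_def continuous_on_discrete)

lemma bounded_orbit_inner:
  assumes "powerbounded T"
  shows "bounded (range (orbit_inner T x y))"
proof -
  obtain M where M: "\<And>n x. norm (mpow T (Suc n) *v x) \<le> M * norm x"
    using assms by (rule powerboundedE) blast
  have "norm (orbit_inner T x y n) \<le> real CARD('a) * ((M * norm x) * (M * norm y))" for n
  proof -
    have "norm (orbit_inner T x y n)
      \<le> real CARD('a) * (norm (mpow T (Suc n) *v x) * norm (mpow T (Suc n) *v y))"
      unfolding orbit_inner_def by (rule norm_cinner_vec_le)
    also have "\<dots> \<le> real CARD('a) * ((M * norm x) * (M * norm y))"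
      \<comment> \<open>Monotonicity needs \<open>M * norm x\<close> to be nonnegative, which the
        bound itself gives at \<open>n = 0\<close>.\<close>
      by (intro mult_left_mono mult_mono M) (use order_trans[OF norm_ge_zero M[of 0 x]] in \<open>simp_all only: norm_ge_zero of_nat_0_le_iff\<close>)
    finally show ?thesis .
  qed
  then show ?thesis by (auto simp: bounded_iff)
qed

text \<open>The coefficients do not depend on \<open>A\<close>. As \<open>A\<close> runs through the
  powers of \<open>T\<close>, every orbit sequence is therefore one fixed finite combination of the
  sequences for pairs of basis vectors.\<close>

lemma cinner_vec_expand:
  "cinner_vec (A *v x) (A *v y) = (\<Sum>j\<in>UNIV. \<Sum>i\<in>UNIV. (x $ j * cnj (y $ i)) *
     cinner_vec (A *v axis j 1) (A *v axis i 1))"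
proof -
  have "cinner_vec (A *v x) (A *v y) =
      (\<Sum>k\<in>UNIV. (\<Sum>j\<in>UNIV. A $ k $ j * x $ j) * (\<Sum>i\<in>UNIV. cnj (A $ k $ i) * cnj (y $ i)))"
    by (simp add: cinner_vec_def matrix_vector_mult_def)
  also have "\<dots> = (\<Sum>k\<in>UNIV. \<Sum>j\<in>UNIV. \<Sum>i\<in>UNIV. (x $ j * cnj (y $ i)) * (A $ k $ j * cnj (A $ k $ i)))"
    unfolding sum_product by (simp add: algebra_simps)
  also have "\<dots> = (\<Sum>j\<in>UNIV. \<Sum>k\<in>UNIV. \<Sum>i\<in>UNIV. (x $ j * cnj (y $ i)) * (A $ k $ j * cnj (A $ k $ i)))"
    by (rule sum.swap)
  also have "\<dots> = (\<Sum>j\<in>UNIV. \<Sum>i\<in>UNIV. \<Sum>k\<in>UNIV. (x $ j * cnj (y $ i)) * (A $ k $ j * cnj (A $ k $ i)))"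
    by (intro sum.cong refl sum.swap)
  finally show ?thesis
    by (simp add: cinner_vec_def matrix_mult_axis sum_distrib_left)
qed

lemma cinner_vec_mult_expand:
  "cinner_vec (A *v x) y = (\<Sum>j\<in>UNIV. \<Sum>i\<in>UNIV. (x $ j * cnj (y $ i)) * A $ i $ j)"
proof -
  have "cinner_vec (A *v x) y = (\<Sum>i\<in>UNIV. \<Sum>j\<in>UNIV. (x $ j * cnj (y $ i)) * A $ i $ j)"
    by (simp add: cinner_vec_def matrix_vector_mult_def sum_distrib_left sum_distrib_right algebra_simps)
  then show ?thesis by (subst sum.swap)
qed

lemma apply_bcontfun_sum:
  fixes f :: "'i \<Rightarrow> 'a::topological_space \<Rightarrow>\<^sub>C 'b::real_normed_vector"
  shows "apply_bcontfun (\<Sum>i\<in>I. f i) x = (\<Sum>i\<in>I. apply_bcontfun (f i) x)"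
  by (induction I rule: infinite_finite_induct) auto

text \<open>Resolves the definite description. The values of \<open>L\<close> on basis pairs form a
  matrix, linearity extends the formula to all vectors, positivity is inherited from
  \<open>L\<close>, and the form determines the entries.\<close>

lemma asymptotic_limit_cinner:
  assumes T: "powerbounded T" and L: "banach_limit L"
  shows "cinner_vec (asymptotic_limit L T *v x) y = L (Bcontfun (orbit_inner T x y))"
proof -
  define F where "F x y = Bcontfun (orbit_inner T x y)" for x y
  have F: "apply_bcontfun (F x y) = orbit_inner T x y" for x y
    unfolding F_def by (rule apply_Bcontfun_nat[OF bounded_orbit_inner[OF T]])
  define A where "A = (\<chi> i j. L (F (axis j 1) (axis i 1)))"
  interpret bounded_linear L using L by (simp add: banach_limit_def)
  \<comment> \<open>\<open>bounded_linear\<close> gives real linearity only; complex scalars come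
    from a separate clause of \<open>banach_limit\<close>.\<close>
  have hom: "L g = c * L f" if "\<And>n. apply_bcontfun g n = c * apply_bcontfun f n" for c f g
    using L that unfolding banach_limit_def by blast
  have A: "cinner_vec (A *v x) y = L (F x y)" for x y
  proof -
    define G where "G j i = Bcontfun (\<lambda>n. (x $ j * cnj (y $ i)) * orbit_inner T (axis j 1) (axis i 1) n)" for j i
    have G: "apply_bcontfun (G j i) n = (x $ j * cnj (y $ i)) * orbit_inner T (axis j 1) (axis i 1) n" for j i n
    proof -
      obtain B where "norm (orbit_inner T (axis j 1) (axis i 1) n) \<le> B" for n
        using bounded_orbit_inner[OF T] unfolding bounded_iff by blast
      then have "norm ((x $ j * cnj (y $ i)) * orbit_inner T (axis j 1) (axis i 1) n)
          \<le> norm (x $ j * cnj (y $ i)) * B" for n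
        unfolding norm_mult[of "x $ j * cnj (y $ i)"] by (intro mult_left_mono) auto
      then have "bounded (range (\<lambda>n. (x $ j * cnj (y $ i)) * orbit_inner T (axis j 1) (axis i 1) n))"
        unfolding bounded_iff by blast
      then show ?thesis unfolding G_def by (simp add: apply_Bcontfun_nat)
    qed
    have "F x y = (\<Sum>j\<in>UNIV. \<Sum>i\<in>UNIV. G j i)"
      by (rule bcontfun_eqI) (simp only: F apply_bcontfun_sum G orbit_inner_def flip: cinner_vec_expand)
    then have "L (F x y) = (\<Sum>j\<in>UNIV. \<Sum>i\<in>UNIV. L (G j i))"
      by (simp add: sum)
    also have "\<dots> = (\<Sum>j\<in>UNIV. \<Sum>i\<in>UNIV. (x $ j * cnj (y $ i)) * A $ i $ j)"
      using hom[of "G j i" "x $ j * cnj (y $ i)" "F (axis j 1) (axis i 1)" for i j] by (simp add: G F A_def)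
    also have "\<dots> = cinner_vec (A *v x) y"
      by (rule cinner_vec_mult_expand[symmetric])
    finally show ?thesis ..
  qed
  have pos: "positive_matrix A"
    unfolding positive_matrix_def
  proof
    fix x
    have "cinner_vec z z \<in> \<real> \<and> 0 \<le> Re (cinner_vec z z)" for z :: "complex ^ 'a"
      by (simp add: cinner_vec_self sum_nonneg del: of_real_sum)
    then have "\<forall>n. apply_bcontfun (F x x) n \<in> \<real> \<and> 0 \<le> Re (apply_bcontfun (F x x) n)"
      by (simp add: F orbit_inner_def)
    then have "L (F x x) \<in> \<real> \<and> 0 \<le> Re (L (F x x))"
      using L unfolding banach_limit_def by blast
    then show "cinner_vec (A *v x) x \<in> \<real> \<and> 0 \<le> Re (cinner_vec (A *v x) x)"
      by (simp add: A)
  qed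
  have "asymptotic_limit L T = A"
    unfolding asymptotic_limit_def
  proof (rule the_equality)
    show "positive_matrix A \<and> (\<forall>x y. cinner_vec (A *v x) y =
        L (Bcontfun (\<lambda>n. cinner_vec (mpow T (Suc n) *v x) (mpow T (Suc n) *v y))))"
      using pos A by (simp add: F_def orbit_inner_def[abs_def] del: mpow.simps)
  next
    fix B
    assume "positive_matrix B \<and> (\<forall>x y. cinner_vec (B *v x) y =
        L (Bcontfun (\<lambda>n. cinner_vec (mpow T (Suc n) *v x) (mpow T (Suc n) *v y))))"
    then have "cinner_vec (B *v x) y = cinner_vec (A *v x) y" for x y
      using A by (simp add: F_def orbit_inner_def[abs_def] del: mpow.simps)
    then show "B = A"
      by (metis cinner_vec_axis vec_eq_iff)
  qed
  then show ?thesis using A by (simp add: F_def)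
qed

text \<open>An orbit tending to 0 has inner products tending to 0 with every bounded orbit, and
  \<open>L\<close> agrees with ordinary limits.\<close>

lemma asymptotic_limit_kernel:
  assumes T: "powerbounded T" and L: "banach_limit L"
    and x: "(\<lambda>n. mpow T n *v x) \<longlonglongrightarrow> 0"
  shows "asymptotic_limit L T *v x = 0"
proof -
  have "cinner_vec (asymptotic_limit L T *v x) y = 0" for y
  proof -
    obtain M where M: "\<And>n x. norm (mpow T (Suc n) *v x) \<le> M * norm x"
      using T by (rule powerboundedE) blast
    have "orbit_inner T x y \<longlonglongrightarrow> 0"
    proof (rule Lim_null_comparison)
      show "\<forall>\<^sub>F n in sequentially. norm (orbit_inner T x y n)
          \<le> real CARD('a) * (norm (mpow T (Suc n) *v x) * (M * norm y))"
      proof (intro always_eventually allI)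
        fix n
        have "norm (orbit_inner T x y n)
            \<le> real CARD('a) * (norm (mpow T (Suc n) *v x) * norm (mpow T (Suc n) *v y))"
          unfolding orbit_inner_def by (rule norm_cinner_vec_le)
        also have "\<dots> \<le> real CARD('a) * (norm (mpow T (Suc n) *v x) * (M * norm y))"
          by (intro mult_left_mono M) auto
        finally show "norm (orbit_inner T x y n)
            \<le> real CARD('a) * (norm (mpow T (Suc n) *v x) * (M * norm y))" .
      qed
      have "(\<lambda>n. real CARD('a) * (norm (mpow T (Suc n) *v x) * (M * norm y))) \<longlonglongrightarrow>
          real CARD('a) * (norm (0 :: complex ^ 'a) * (M * norm y))"
        using LIMSEQ_Suc[OF x] by (intro tendsto_intros)
      then show "(\<lambda>n. real CARD('a) * (norm (mpow T (Suc n) *v x) * (M * norm y))) \<longlonglongrightarrow> 0"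
        by simp
    qed
    then have "L (Bcontfun (orbit_inner T x y)) = 0"
      using L unfolding banach_limit_def
      by (metis apply_Bcontfun_nat bounded_orbit_inner[OF T])
    then show ?thesis by (simp add: asymptotic_limit_cinner[OF T L])
  qed
  then show ?thesis using cinner_vec_self_eq_0 by blast
qed

section \<open>Eigenvectors and Jordan blocks under power boundedness\<close>

lemma mpow_eigenvector:
  assumes "T *v x = l *s x"
  shows "mpow T n *v x = l ^ n *s x"
  by (induction n) (simp_all add: assms vec.scale flip: matrix_vector_mul_assoc)

lemma mat_mult_vector: "mat c *v x = c *s x"
  by (simp add: vec_eq_iff matrix_vector_mult_def mat_def mult_delta_left)

text \<open>The hypotheses make \<open>l\<close> and \<open>m\<close> the roots of the
  characteristic polynomial, so \<open>T - mat l\<close> is singular. Exchanging the roots yields an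
  eigenvector for \<open>m\<close>.\<close>

lemma tr_det_eigenvector:
  fixes T :: "complex ^ 2 ^ 2"
  assumes "T $ 1 $ 1 + T $ 2 $ 2 = l + m" "T $ 1 $ 1 * T $ 2 $ 2 - T $ 1 $ 2 * T $ 2 $ 1 = l * m"
  obtains x where "x \<noteq> 0" "T *v x = l *s x"
proof -
  have "det (T - mat l) = 0"
  proof -
    have "det (T - mat l) = T $ 1 $ 1 * T $ 2 $ 2 - T $ 1 $ 2 * T $ 2 $ 1
        - l * (T $ 1 $ 1 + T $ 2 $ 2) + l * l"
      by (simp add: det_2 mat_def algebra_simps)
    then show ?thesis unfolding assms by (simp add: algebra_simps)
  qed
  then obtain x where "x \<noteq> 0" "(T - mat l) *v x = 0"
    using invertible_det_nz invertible_left_inverse matrix_left_invertible_ker by metis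
  then show ?thesis
    using that by (simp add: matrix_vector_mult_diff_rdistrib mat_mult_vector)
qed

text \<open>Modulus above 1 breaks the power bound on \<open>x\<close>; modulus below 1 puts
  \<open>x\<close> into the kernel of the asymptotic limit, against injectivity.\<close>

lemma unimodular_eigenvalue:
  assumes T: "powerbounded T" and L: "banach_limit L" and inj: "inj (\<lambda>x. asymptotic_limit L T *v x)"
    and x: "x \<noteq> 0" "T *v x = l *s x"
  shows "norm l = 1"
proof -
  obtain M where M: "\<And>n x. norm (mpow T (Suc n) *v x) \<le> M * norm x"
    using T by (rule powerboundedE) blast
  have le: "norm l ^ Suc n \<le> M" for n
    using M[of n x] x by (simp add: mpow_eigenvector norm_vector_smult norm_power del: mpow.simps power_Suc)
  have "norm l \<le> 1"
  proof (rule ccontr)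
    assume "\<not> norm l \<le> 1"
    then obtain n where "M < norm l ^ n" using real_arch_pow[of "norm l" M] by auto
    also have "\<dots> \<le> norm l ^ Suc n"
      using \<open>\<not> norm l \<le> 1\<close> by (intro power_increasing) auto
    finally show False using le[of n] by linarith
  qed
  moreover have "\<not> norm l < 1"
  proof
    assume "norm l < 1"
    have "(\<lambda>n. mpow T n *v x) \<longlonglongrightarrow> 0"
    proof (rule tendsto_norm_zero_cancel)
      have "(\<lambda>n. norm l ^ n * norm x) \<longlonglongrightarrow> 0 * norm x"
        using \<open>norm l < 1\<close> by (intro tendsto_intros LIMSEQ_power_zero) auto
      then show "(\<lambda>n. norm (mpow T n *v x)) \<longlonglongrightarrow> 0"
        by (simp add: mpow_eigenvector[OF x(2)] norm_vector_smult norm_power)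
    qed
    then have "asymptotic_limit L T *v x = asymptotic_limit L T *v 0"
      using asymptotic_limit_kernel[OF T L] by simp
    then show False using injD[OF inj] x(1) by blast
  qed
  ultimately show ?thesis by simp
qed

text \<open>With \<open>l\<close> unimodular and \<open>z\<close> nonzero, the orbit of
  \<open>y\<close> would grow linearly.\<close>

lemma powerbounded_no_jordan_block:
  assumes T: "powerbounded T" and y: "T *v y = l *s y + z" and z: "T *v z = l *s z" and l: "norm l = 1"
  shows "z = 0"
proof (rule ccontr)
  assume "z \<noteq> 0"
  obtain M where M: "\<And>n x. norm (mpow T (Suc n) *v x) \<le> M * norm x"
    using T by (rule powerboundedE) blast
  have "l \<noteq> 0" using l by auto
  \<comment> \<open>Writing \<open>n l^(n-1)\<close> as \<open>l^n (n / l)\<close> avoids a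
    truncated exponent at \<open>n = 0\<close>.\<close>
  have pow: "mpow T n *v y = l ^ n *s (y + (of_nat n / l) *s z)" for n
  proof (induction n)
    case (Suc n)
    have "mpow T (Suc n) *v y = T *v (l ^ n *s (y + (of_nat n / l) *s z))"
      by (simp add: Suc flip: matrix_vector_mul_assoc)
    also have "\<dots> = l ^ n *s (l *s y + z + (of_nat n / l) *s (l *s z))"
      by (simp add: vec.scale vec.add y z)
    also have "\<dots> = l ^ Suc n *s (y + (of_nat (Suc n) / l) *s z)"
      using \<open>l \<noteq> 0\<close> by (simp add: vec_eq_iff field_simps)
    finally show ?case .
  qed simp
  \<comment> \<open>The extra \<open>norm y\<close> pays for the triangle inequality that isolates
    the \<open>z\<close> term.\<close>
  obtain n where n: "real n * norm z > M * norm y + norm y"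
    using \<open>z \<noteq> 0\<close> reals_Archimedean3[of "norm z"] by auto
  have "real n * norm z \<le> real (Suc n) * norm z" by (intro mult_right_mono) auto
  also have "\<dots> = norm ((of_nat (Suc n) / l) *s z)"
    using l by (simp add: norm_vector_smult norm_divide del: of_nat_Suc)
  also have "\<dots> \<le> norm (y + (of_nat (Suc n) / l) *s z) + norm y"
    by (metis add_diff_cancel_left' norm_triangle_ineq4)
  also have "norm (y + (of_nat (Suc n) / l) *s z) = norm (mpow T (Suc n) *v y)"
    unfolding pow norm_vector_smult norm_power l by simp
  also have "\<dots> \<le> M * norm y" by (rule M)
  finally show False using n by simp
qed

section \<open>Powers and Cesaro means of a spectral sum\<close>

definition complementary :: "complex ^ 'n ^ 'n \<Rightarrow> complex ^ 'n ^ 'n \<Rightarrow> bool" where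
  "complementary P Q \<longleftrightarrow> P ** P = P \<and> Q ** Q = Q \<and> P ** Q = 0 \<and> Q ** P = 0 \<and> P + Q = mat 1"

text \<open>Under \<open>complementary P Q\<close> this is a spectral form: the operator acts as
  \<open>l\<close> on the range of \<open>P\<close> and as \<open>m\<close> on the range of
  \<open>Q\<close>.\<close>

definition lincomb :: "complex \<Rightarrow> complex ^ 'n ^ 'm \<Rightarrow> complex \<Rightarrow> complex ^ 'n ^ 'm \<Rightarrow> complex ^ 'n ^ 'm" where
  "lincomb l P m Q = (\<chi> i j. l * P $ i $ j + m * Q $ i $ j)"

lemma lincomb_mult:
  "lincomb a A b B ** lincomb c C d D =
     lincomb 1 (lincomb (a * c) (A ** C) (a * d) (A ** D)) 1 (lincomb (b * c) (B ** C) (b * d) (B ** D))"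
  by (simp add: vec_eq_iff lincomb_def matrix_matrix_mult_def sum_distrib_left sum.distrib algebra_simps)

lemma mpow_lincomb:
  assumes "complementary P Q"
  shows "mpow (lincomb l P m Q) n = lincomb (l ^ n) P (m ^ n) Q"
proof (induction n)
  case 0
  have "P + Q = mat 1" using assms by (simp add: complementary_def)
  then show ?case by (simp add: lincomb_def vec_eq_iff)
next
  case (Suc n)
  then show ?case
    using assms by (simp add: lincomb_mult complementary_def) (simp add: lincomb_def vec_eq_iff)
qed

lemma cadjoint_mult: "cadjoint (A ** B) = cadjoint B ** cadjoint A"
  by (simp add: cadjoint_def matrix_matrix_mult_def vec_eq_iff mult.commute)

lemma cadjoint_lincomb: "cadjoint (lincomb l P m Q) = lincomb (cnj l) (cadjoint P) (cnj m) (cadjoint Q)"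
  by (simp add: cadjoint_def lincomb_def vec_eq_iff)

lemma cadjoint_cadjoint [simp]: "cadjoint (cadjoint A) = A"
  by (simp add: cadjoint_def vec_eq_iff)

lemma complementary_cadjoint:
  assumes "complementary P Q"
  shows "complementary (cadjoint P) (cadjoint Q)"
proof -
  have "cadjoint P + cadjoint Q = mat 1"
  proof -
    have "cadjoint P + cadjoint Q = cadjoint (P + Q)"
      by (simp add: cadjoint_def vec_eq_iff)
    also have "\<dots> = mat 1"
      using assms by (auto simp: complementary_def cadjoint_def vec_eq_iff mat_def)
    finally show ?thesis .
  qed
  moreover have "cadjoint 0 = (0 :: complex ^ 'a ^ 'a)"
    by (simp add: cadjoint_def vec_eq_iff)
  ultimately show ?thesis
    using assms unfolding complementary_def by (metis cadjoint_mult)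
qed

text \<open>The geometric sums stay bounded by \<open>2 / norm (1 - z)\<close>, so division by
  \<open>n\<close> sends them to 0.\<close>

lemma cesaro_powers:
  fixes z :: complex
  assumes "norm z = 1" "z \<noteq> 1"
  shows "(\<lambda>n. (\<Sum>j=1..n. z ^ j) / of_nat n) \<longlonglongrightarrow> 0"
proof (rule Lim_null_comparison)
  have "norm ((\<Sum>j=1..n. z ^ j) / of_nat n) \<le> (2 / norm (1 - z)) / real n" for n
  proof -
    have "(\<Sum>j=1..n. z ^ j) * (1 - z) = z - z ^ Suc n"
    proof (induction n)
      case (Suc n)
      have "(\<Sum>j=1..Suc n. z ^ j) * (1 - z) = (\<Sum>j=1..n. z ^ j) * (1 - z) + z ^ Suc n * (1 - z)"
        by (simp add: distrib_right)
      also have "\<dots> = z - z ^ Suc (Suc n)"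
        unfolding Suc.IH by (simp add: algebra_simps)
      finally show ?case .
    qed simp
    then have "(\<Sum>j=1..n. z ^ j) = (z - z ^ Suc n) / (1 - z)"
      using assms by (simp add: field_simps)
    moreover have "norm (z - z ^ Suc n) \<le> 2"
      using norm_triangle_ineq4[of z "z ^ Suc n"] assms by (simp add: norm_mult norm_power)
    ultimately show ?thesis
      unfolding norm_divide norm_of_nat by (simp add: norm_divide divide_right_mono del: divide_divide_eq_left)
  qed
  then show "\<forall>\<^sub>F n in sequentially. norm ((\<Sum>j=1..n. z ^ j) / of_nat n) \<le> (2 / norm (1 - z)) / real n"
    by simp
  show "(\<lambda>n. (2 / norm (1 - z)) / real n) \<longlonglongrightarrow> 0"
    by (rule lim_const_over_n)
qed

text \<open>Unimodularity turns the coefficients of the two Gram terms into 1, while the cross terms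
  carry powers of \<open>z\<close> and its conjugate, which average to 0.\<close>

lemma cesaro_mean_lincomb:
  fixes P Q :: "complex ^ 'n ^ 'n"
  assumes PQ: "complementary P Q" and l: "norm l = 1" and m: "norm m = 1" and "l \<noteq> m"
  shows "cesaro_mean (lincomb l P m Q) \<longlonglongrightarrow> cadjoint P ** P + cadjoint Q ** Q"
proof -
  let ?T = "lincomb l P m Q"
  \<comment> \<open>As \<open>l\<close> is unimodular, \<open>z\<close> is the ratio
    \<open>m / l\<close>, which differs from 1.\<close>
  define z where "z = cnj l * m"
  have cl: "cnj l * l = 1" and cm: "cnj m * m = 1"
    using l m by (metis complex_norm_square mult.commute of_real_1 power_one)+
  have "z \<noteq> 1" using cl \<open>l \<noteq> m\<close> unfolding z_def
    by (metis mult_cancel_left mult_zero_left zero_neq_one)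
  have nz: "norm z = 1" using l m by (simp add: z_def norm_mult)
  have *: "(mpow (cadjoint ?T) j ** mpow ?T j) $ i $ k = (cadjoint P ** P + cadjoint Q ** Q) $ i $ k
      + (z ^ j * (cadjoint P ** Q) $ i $ k + cnj z ^ j * (cadjoint Q ** P) $ i $ k)" for i j k
  proof -
    have "cnj l ^ j * l ^ j = 1" "cnj m ^ j * m ^ j = 1" "cnj l ^ j * m ^ j = z ^ j" "cnj m ^ j * l ^ j = cnj z ^ j"
      using cl cm by (simp_all add: z_def mult.commute flip: power_mult_distrib)
    then show ?thesis
      by (simp add: cadjoint_lincomb mpow_lincomb PQ complementary_cadjoint lincomb_mult) (simp add: lincomb_def)
  qed
  have "(\<lambda>n. cesaro_mean ?T n $ i $ k) \<longlonglongrightarrow> (cadjoint P ** P + cadjoint Q ** Q) $ i $ k" for i k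
  proof -
    let ?c = "(cadjoint P ** P + cadjoint Q ** Q) $ i $ k"
    \<comment> \<open>\<open>n \<ge> 1\<close> allows \<open>of_nat n\<close> to cancel; at
      \<open>n = 0\<close> the mean is the zero matrix.\<close>
    have "cesaro_mean ?T n $ i $ k = ?c + ((\<Sum>j=1..n. z ^ j) / of_nat n * (cadjoint P ** Q) $ i $ k
        + (\<Sum>j=1..n. cnj z ^ j) / of_nat n * (cadjoint Q ** P) $ i $ k)" if "n \<ge> 1" for n
    proof -
      have "cesaro_mean ?T n $ i $ k = (\<Sum>j=1..n. (mpow (cadjoint ?T) j ** mpow ?T j) $ i $ k) / of_nat n"
        unfolding cesaro_mean_def vector_scaleR_component sum_component
        by (simp add: scaleR_conv_of_real)
      also have "\<dots> = (of_nat n * ?c + ((\<Sum>j=1..n. z ^ j) * (cadjoint P ** Q) $ i $ k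
        + (\<Sum>j=1..n. cnj z ^ j) * (cadjoint Q ** P) $ i $ k)) / of_nat n"
        unfolding * by (simp add: sum.distrib sum_distrib_right)
      finally show ?thesis using that by (simp add: add_divide_distrib)
    qed
    then have "\<forall>\<^sub>F n in sequentially. ?c + ((\<Sum>j=1..n. z ^ j) / of_nat n * (cadjoint P ** Q) $ i $ k
        + (\<Sum>j=1..n. cnj z ^ j) / of_nat n * (cadjoint Q ** P) $ i $ k) = cesaro_mean ?T n $ i $ k"
      by (intro eventually_sequentiallyI[of 1]) simp
    moreover have "(\<lambda>n. ?c + ((\<Sum>j=1..n. z ^ j) / of_nat n * (cadjoint P ** Q) $ i $ k
        + (\<Sum>j=1..n. cnj z ^ j) / of_nat n * (cadjoint Q ** P) $ i $ k)) \<longlonglongrightarrow>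
        ?c + (0 * (cadjoint P ** Q) $ i $ k + 0 * (cadjoint Q ** P) $ i $ k)"
      using nz \<open>z \<noteq> 1\<close> by (intro tendsto_intros cesaro_powers) (auto simp: complex_cnj_one_iff)
    ultimately show ?thesis by (simp add: Lim_transform_eventually)
  qed
  then show ?thesis
    by (intro vec_tendstoI) 
qed

section \<open>Algebra of two-by-two idempotents\<close>

text \<open>The primed variables stand for conjugates, made independent so that the claim is
  polynomial. The left side is the determinant of the sum \<open>A\<close> in
  \<open>idempotent_gram_sums\<close>; the right side is half its trace, the squared Frobenius norm
  of \<open>P\<close>.\<close>

lemma rank_one_projection_identity:
  fixes a b c d a' b' c' d' :: complex
  assumes "a + d = 1" "a * d = b * c" "a' + d' = 1" "a' * d' = b' * c'"
  shows "(a * a' + d * d' + 2 * (c * c')) * (a * a' + d * d' + 2 * (b * b'))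
     - (b * (a' - d') - c' * (a - d)) * (b' * (a - d) - c * (a' - d'))
     = a * a' + b * b' + c * c' + d * d'"
  using assms by algebra

definition adjugate2 :: "complex ^ 2 ^ 2 \<Rightarrow> complex ^ 2 ^ 2" where
  "adjugate2 A = vector [vector [A $ 2 $ 2, - A $ 1 $ 2], vector [- A $ 2 $ 1, A $ 1 $ 1]]"

text \<open>In dimension two the adjugate is the trace times \<open>mat 1\<close> minus the matrix,
  here \<open>mat 1 - P\<close>. By Cayley-Hamilton, trace 1 and determinant 0 make \<open>P\<close>
  idempotent.\<close>

lemma complementary_adjugate2:
  assumes "P $ 1 $ 1 + P $ 2 $ 2 = 1" "P $ 1 $ 1 * P $ 2 $ 2 = P $ 1 $ 2 * P $ 2 $ 1"
  shows "complementary P (adjugate2 P)"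
proof -
  have d: "P $ 2 $ 2 = 1 - P $ 1 $ 1"
    using assms(1) by (simp add: algebra_simps)
  show ?thesis
    using assms(2) unfolding d
    by (auto simp: complementary_def adjugate2_def vec_eq_iff forall_2 matrix_matrix_mult_def sum_2 mat_def d algebra_simps)
qed

text \<open>The two-by-two adjugate is additive, reverses products, commutes with
  \<open>cadjoint\<close> and swaps \<open>P\<close> and \<open>Q\<close>, so it sends
  \<open>A\<close> to \<open>B\<close>. A matrix times its adjugate gives the determinant, and plus
  its adjugate gives the trace.\<close>

lemma idempotent_gram_sums:
  fixes P :: "complex ^ 2 ^ 2"
  assumes tr: "P $ 1 $ 1 + P $ 2 $ 2 = 1" and det: "P $ 1 $ 1 * P $ 2 $ 2 = P $ 1 $ 2 * P $ 2 $ 1"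
  defines "Q \<equiv> adjugate2 P"
  defines "A \<equiv> cadjoint P ** P + cadjoint Q ** Q" and "B \<equiv> P ** cadjoint P + Q ** cadjoint Q"
  obtains s :: real where "s > 0" "A ** B = s *\<^sub>R mat 1" "B ** A = s *\<^sub>R mat 1" "A + B = (2 * s) *\<^sub>R mat 1"
proof
  define a b c d where "a = P $ 1 $ 1" and "b = P $ 1 $ 2" and "c = P $ 2 $ 1" and "d = P $ 2 $ 2"
  define s where "s = (norm a)\<^sup>2 + (norm b)\<^sup>2 + (norm c)\<^sup>2 + (norm d)\<^sup>2"
  have ad: "a + d = 1" "a * d = b * c" using tr det by (simp_all add: a_def b_def c_def d_def)
  then have cad: "cnj a + cnj d = 1" "cnj a * cnj d = cnj b * cnj c"
    by (metis complex_cnj_add complex_cnj_one, metis complex_cnj_mult)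
  have s: "complex_of_real s = a * cnj a + b * cnj b + c * cnj c + d * cnj d"
    by (simp add: s_def complex_norm_square del: of_real_power)
  have "a \<noteq> 0 \<or> d \<noteq> 0" using ad by auto
  then show "s > 0" by (auto simp: s_def add_nonneg_pos add_pos_nonneg)
  have P: "P = vector [vector [a, b], vector [c, d]]"
    by (simp add: vec_eq_iff forall_2 a_def b_def c_def d_def)
  have A: "A = vector [vector [a * cnj a + d * cnj d + 2 * (c * cnj c), b * (cnj a - cnj d) - cnj c * (a - d)],
      vector [cnj b * (a - d) - c * (cnj a - cnj d), a * cnj a + d * cnj d + 2 * (b * cnj b)]]"
    by (simp add: A_def Q_def P adjugate2_def cadjoint_def vec_eq_iff forall_2 matrix_matrix_mult_def sum_2 algebra_simps)
  have B: "B = vector [vector [a * cnj a + d * cnj d + 2 * (b * cnj b), - (b * (cnj a - cnj d) - cnj c * (a - d))],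
      vector [- (cnj b * (a - d) - c * (cnj a - cnj d)), a * cnj a + d * cnj d + 2 * (c * cnj c)]]"
    by (simp add: B_def Q_def P adjugate2_def cadjoint_def vec_eq_iff forall_2 matrix_matrix_mult_def sum_2 algebra_simps)
  note key = rank_one_projection_identity[OF ad cad, folded s]
  have scalar: "r *\<^sub>R mat 1 = (vector [vector [of_real r, 0], vector [0, of_real r]] :: complex ^ 2 ^ 2)" for r
    by (simp add: vec_eq_iff forall_2 mat_def of_real_def)
  show "A ** B = s *\<^sub>R mat 1" "B ** A = s *\<^sub>R mat 1"
    unfolding A B scalar
    using key by (simp_all add: vec_eq_iff forall_2 matrix_matrix_mult_def sum_2 algebra_simps)
  show "A + B = (2 * s) *\<^sub>R mat 1"
    unfolding A B scalar
    using s by (simp add: vec_eq_iff forall_2)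
qed

section \<open>Spectral form of the matrices in \<open>C11\<close>\<close>

text \<open>This is \<open>(T - m)(T - l) = 0\<close> applied to \<open>y\<close>. For
  \<open>l = m\<close> the vector \<open>T *v y - l *s y\<close> can serve as \<open>z\<close> in
  \<open>powerbounded_no_jordan_block\<close>.\<close>

lemma cayley_hamilton_2:
  fixes T :: "complex ^ 2 ^ 2"
  assumes "T $ 1 $ 1 + T $ 2 $ 2 = l + m" "T $ 1 $ 1 * T $ 2 $ 2 - T $ 1 $ 2 * T $ 2 $ 1 = l * m"
  shows "T *v (T *v y - l *s y) = m *s (T *v y - l *s y)"
proof -
  have "\<forall>i. T $ i $ 1 * (T $ 1 $ 1 * y $ 1 + T $ 1 $ 2 * y $ 2 - l * y $ 1) +
      T $ i $ 2 * (T $ 2 $ 1 * y $ 1 + T $ 2 $ 2 * y $ 2 - l * y $ 2) =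
      m * (T $ i $ 1 * y $ 1 + T $ i $ 2 * y $ 2 - l * y $ i)"
    unfolding forall_2 by (intro conjI; use assms in algebra)
  then show ?thesis
    by (simp add: vec_eq_iff matrix_vector_mult_def sum_2 right_diff_distrib)
qed

lemma C11_spectral_form:
  fixes T :: "complex ^ 2 ^ 2"
  assumes "T \<in> C11"
  obtains (scalar) l where "norm l = 1" "T = mat l"
    | (distinct) l m P where "norm l = 1" "norm m = 1" "l \<noteq> m"
      "P $ 1 $ 1 + P $ 2 $ 2 = 1" "P $ 1 $ 1 * P $ 2 $ 2 = P $ 1 $ 2 * P $ 2 $ 1"
      "T = lincomb l P m (adjugate2 P)"
proof -
  obtain L where T: "powerbounded T" and L: "banach_limit L"
    and inj: "inj (\<lambda>x. asymptotic_limit L T *v x)"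
    using assms by (auto simp: C11_def)
  define t where "t = T $ 1 $ 1 + T $ 2 $ 2"
  define D where "D = T $ 1 $ 1 * T $ 2 $ 2 - T $ 1 $ 2 * T $ 2 $ 1"
  \<comment> \<open>Quadratic formula: a square root of the discriminant gives both
    eigenvalues.\<close>
  define r where "r = csqrt (t\<^sup>2 - 4 * D)"
  have "r\<^sup>2 = t\<^sup>2 - 4 * D" by (simp add: r_def)
  define l m where "l = (t + r) / 2" and "m = (t - r) / 2"
  have tr: "T $ 1 $ 1 + T $ 2 $ 2 = l + m"
    by (simp add: l_def m_def t_def flip: add_divide_distrib)
  have "l * m = (t\<^sup>2 - r\<^sup>2) / 4"
    by (simp add: l_def m_def power2_eq_square algebra_simps)
  then have det: "T $ 1 $ 1 * T $ 2 $ 2 - T $ 1 $ 2 * T $ 2 $ 1 = l * m"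
    unfolding D_def[symmetric] using \<open>r\<^sup>2 = t\<^sup>2 - 4 * D\<close> by simp
  have tr': "T $ 1 $ 1 + T $ 2 $ 2 = m + l"
    and det': "T $ 1 $ 1 * T $ 2 $ 2 - T $ 1 $ 2 * T $ 2 $ 1 = m * l"
    using tr det by (simp_all add: ac_simps)
  have l: "norm l = 1"
    using tr_det_eigenvector[OF tr det] unimodular_eigenvalue[OF T L inj] by metis
  have m: "norm m = 1"
    using tr_det_eigenvector[OF tr' det'] unimodular_eigenvalue[OF T L inj] by metis
  show ?thesis
  proof (cases "l = m")
    case True
    have "T *v y = mat l *v y" for y
    proof -
      have "T *v (T *v y - l *s y) = l *s (T *v y - l *s y)"
        using cayley_hamilton_2[OF tr det] True by simp
      then have "T *v y - l *s y = 0"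
        by (intro powerbounded_no_jordan_block[OF T, of y l]) (simp_all add: l)
      then show ?thesis by (simp add: mat_mult_vector)
    qed
    then have "T = mat l" by (simp add: matrix_eq)
    then show ?thesis using scalar l by blast
  next
    case False
    \<comment> \<open>\<open>(T - m) / (l - m)\<close> interpolates 1 at \<open>l\<close> and 0 at
      \<open>m\<close>, so it is the spectral idempotent for \<open>l\<close>.\<close>
    define P :: "complex ^ 2 ^ 2" where "P = (\<chi> i j. (T $ i $ j - (if i = j then m else 0)) / (l - m))"
    have "P $ 1 $ 1 + P $ 2 $ 2 = (T $ 1 $ 1 + T $ 2 $ 2 - 2 * m) / (l - m)"
      by (simp add: P_def flip: add_divide_distrib)
    then have trP: "P $ 1 $ 1 + P $ 2 $ 2 = 1"
      using False by (simp add: tr)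
    \<comment> \<open>The determinant of \<open>T - mat m\<close> vanishes because \<open>m\<close>
      is an eigenvalue.\<close>
    have "(T $ 1 $ 1 - m) * (T $ 2 $ 2 - m) = T $ 1 $ 2 * T $ 2 $ 1"
      using tr det by algebra
    then have detP: "P $ 1 $ 1 * P $ 2 $ 2 = P $ 1 $ 2 * P $ 2 $ 1"
      by (simp add: P_def)
    have "(l - m) * P $ 1 $ 1 = T $ 1 $ 1 - m" "(l - m) * P $ 2 $ 2 = T $ 2 $ 2 - m"
      "(l - m) * P $ 1 $ 2 = T $ 1 $ 2" "(l - m) * P $ 2 $ 1 = T $ 2 $ 1"
      using False by (simp_all add: P_def)
    \<comment> \<open>\<open>trP\<close> replaces \<open>1 - P $ 1 $ 1\<close> by
      \<open>P $ 2 $ 2\<close>, the entry of the adjugate, and likewise for the other diagonal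
      entry.\<close>
    then have "T $ 1 $ 1 = l * P $ 1 $ 1 + m * P $ 2 $ 2" "T $ 2 $ 2 = l * P $ 2 $ 2 + m * P $ 1 $ 1"
      "T $ 1 $ 2 = l * P $ 1 $ 2 - m * P $ 1 $ 2" "T $ 2 $ 1 = l * P $ 2 $ 1 - m * P $ 2 $ 1"
      using trP by algebra+
    then have "T = lincomb l P m (adjugate2 P)"
      unfolding vec_eq_iff forall_2 by (simp add: lincomb_def adjugate2_def)
    then show ?thesis using distinct l m False trP detP by blast
  qed
qed

section \<open>Inverses and the harmonic mean\<close>

lemma matrix_inv_eqI:
  assumes "A ** B = mat 1" "B ** A = mat 1"
  shows "matrix_inv A = B"
proof -
  have "A ** matrix_inv A = mat 1 \<and> matrix_inv A ** A = mat 1"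
    unfolding matrix_inv_def by (rule someI[of _ B]) (use assms in simp)
  then show ?thesis
    by (metis assms(2) matrix_mul_assoc matrix_mul_lid matrix_mul_rid)
qed

theorem theorem4:
  fixes T :: "complex ^ 2 ^ 2"
  assumes "T \<in> C11"
  shows "convergent (cesaro_mean T) \<and> convergent (cesaro_mean (cadjoint T)) \<and>
    invertible (cesaro_limit T) \<and> invertible (cesaro_limit (cadjoint T)) \<and>
    matrix_inv (cesaro_limit T) + matrix_inv (cesaro_limit (cadjoint T)) = 2 *\<^sub>R mat 1"
proof -
  \<comment> \<open>Both spectral cases are brought to one normal form; the scalar case has
    \<open>s = 1\<close>.\<close>
  obtain l m P Q s where "norm l = 1" "norm m = 1" "l \<noteq> m" "complementary P Q"
    and T: "T = lincomb l P m Q" and s: "(s :: real) > 0"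
    and AB: "(cadjoint P ** P + cadjoint Q ** Q) ** (P ** cadjoint P + Q ** cadjoint Q) = s *\<^sub>R mat 1"
    and BA: "(P ** cadjoint P + Q ** cadjoint Q) ** (cadjoint P ** P + cadjoint Q ** Q) = s *\<^sub>R mat 1"
    and sum: "(cadjoint P ** P + cadjoint Q ** Q) + (P ** cadjoint P + Q ** cadjoint Q) = (2 * s) *\<^sub>R mat 1"
    using assms
  proof (cases rule: C11_spectral_form)
    case (scalar l)
    \<comment> \<open>The averaging lemma needs two distinct coefficients, hence \<open>l\<cdot>1 + (- l)\<cdot>0\<close>.\<close>
    have "cadjoint (mat 1) = (mat 1 :: complex ^ 2 ^ 2)" "cadjoint 0 = (0 :: complex ^ 2 ^ 2)"
      by (auto simp: cadjoint_def vec_eq_iff mat_def)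
    moreover have "complementary (mat 1) (0 :: complex ^ 2 ^ 2)"
      by (simp add: complementary_def)
    moreover have "T = lincomb l (mat 1) (- l) 0"
      using scalar by (simp add: lincomb_def vec_eq_iff mat_def)
    moreover have "mat 1 + mat 1 = 2 *\<^sub>R (mat 1 :: complex ^ 2 ^ 2)"
      by (simp add: scaleR_2)
    moreover have "l \<noteq> - l" using scalar(1) by auto
    ultimately show ?thesis
      using scalar(1) by (intro that[of l "- l" "mat 1" 0 1]) simp_all
  next
    case (distinct l m P)
    from idempotent_gram_sums[OF distinct(4,5)] obtain s :: real where "s > 0"
      "(cadjoint P ** P + cadjoint (adjugate2 P) ** adjugate2 P) **
        (P ** cadjoint P + adjugate2 P ** cadjoint (adjugate2 P)) = s *\<^sub>R mat 1"
      "(P ** cadjoint P + adjugate2 P ** cadjoint (adjugate2 P)) **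
        (cadjoint P ** P + cadjoint (adjugate2 P) ** adjugate2 P) = s *\<^sub>R mat 1"
      "(cadjoint P ** P + cadjoint (adjugate2 P) ** adjugate2 P) +
        (P ** cadjoint P + adjugate2 P ** cadjoint (adjugate2 P)) = (2 * s) *\<^sub>R mat 1"
      by blast
    then show ?thesis
      using distinct complementary_adjugate2[OF distinct(4,5)] by (intro that)
  qed
  define A where "A = cadjoint P ** P + cadjoint Q ** Q"
  define B where "B = P ** cadjoint P + Q ** cadjoint Q"
  have A: "cesaro_mean T \<longlonglongrightarrow> A"
    unfolding T A_def by (rule cesaro_mean_lincomb) fact+
  \<comment> \<open>The adjoint has conjugate coefficients and adjoint idempotents, so the averaging
    lemma applies again.\<close>
  have "cesaro_mean (cadjoint T) \<longlonglongrightarrow> cadjoint (cadjoint P) ** cadjoint P + cadjoint (cadjoint Q) ** cadjoint Q"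
    unfolding T cadjoint_lincomb using \<open>norm l = 1\<close> \<open>norm m = 1\<close> \<open>l \<noteq> m\<close> \<open>complementary P Q\<close>
    by (intro cesaro_mean_lincomb complementary_cadjoint) auto
  then have B: "cesaro_mean (cadjoint T) \<longlonglongrightarrow> B"
    by (simp add: B_def)
  \<comment> \<open>Since both products of \<open>A\<close> and \<open>B\<close> equal
    \<open>s\<close> times the identity, each matrix divided by \<open>s\<close> inverts the
    other.\<close>
  have AB': "A ** ((1 / s) *\<^sub>R B) = mat 1" "((1 / s) *\<^sub>R B) ** A = mat 1"
    "B ** ((1 / s) *\<^sub>R A) = mat 1" "((1 / s) *\<^sub>R A) ** B = mat 1"
    using s AB BA by (simp_all add: A_def B_def matrix_scalar_ac flip: scalar_matrix_assoc)
  have lim: "cesaro_limit T = A" "cesaro_limit (cadjoint T) = B"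
    using A B by (simp_all add: cesaro_limit_def limI)
  have "matrix_inv A + matrix_inv B = (1 / s) *\<^sub>R (A + B)"
    using AB' by (simp add: matrix_inv_eqI scaleR_add_right add.commute)
  also have "\<dots> = 2 *\<^sub>R mat 1"
    using s sum by (simp add: A_def B_def)
  finally show ?thesis
    using A B AB' unfolding lim invertible_def convergent_def by blast
qed

end
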